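(* Let $S$ be a finite semigroup. The cyclic graph $\Gamma(S)$ is complete if and only if one of the following holds for some $r\in\mathbb{N}$: (i) $S=\langle a : a^{1+r}=a\rangle$; (ii) $S=\langle a : a^{2+r}=a^2\rangle$; (iii) $S=\langle a : a^{3+r}=a^3\rangle$ where $r$ is odd.
   Context: Semigroups are nonempty. $\mathbb{N}$ is the set of positive integers. For a subset $X\subseteq S$, $\langle X\rangle$ is the subsemigroup generated by $X$; $\langle a\rangle=\{a^k:k\in\mathbb{N}\}$. A semigroup is monogenic if it equals $\langle a\rangle$ for some element $a$. For an element $a$ of a finite semigroup, the index $m$ of $a$ is the least $x\in\mathbb{N}$ such that $a^x=a^y$ for some $y\in\mathbb{N}$, $y\neq x$, and the period $r$ of $a$ is the least $x\in\mathbb{N}$ with $a^{m+x}=a^m$. Writing $S=\langle a : a^{m+r}=a^m\rangle$ (also denoted $M(m,r)$) means that $S=\langle a\rangle$ for some $a\in S$ with index exactly $m$ and period exactly $r$. The cyclic graph $\Gamma(S)$ is the simple graph with vertex set $S$ in which two distinct $x,y$ are adjacent if and only if $\langle x,y\rangle=\langle z\rangle$ for some $z\in S$. A graph is complete if any two distinct vertices are adjacent. *)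

theory Defs
  imports "Graph_Theory.Graph_Theory"
begin

text \<open>
  The library's \<^locale>\<open>semigroup\<close> requires the operation to be associative on a whole type. Here a
  semigroup has an explicit carrier \<open>S\<close>; nothing is assumed about \<open>f\<close> outside \<open>S\<close>.
\<close>

locale finite_semigroup =
  fixes S :: "'a set" and f :: "'a \<Rightarrow> 'a \<Rightarrow> 'a"
  assumes closed: "\<lbrakk>x \<in> S; y \<in> S\<rbrakk> \<Longrightarrow> f x y \<in> S"
    and assoc: "\<lbrakk>x \<in> S; y \<in> S; z \<in> S\<rbrakk> \<Longrightarrow> f (f x y) z = f x (f y z)"
    and nonempty: "S \<noteq> {}"
    and finite_carrier: "finite S"

inductive_set sgen :: "('a \<Rightarrow> 'a \<Rightarrow> 'a) \<Rightarrow> 'a set \<Rightarrow> 'a set"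
  for f :: "'a \<Rightarrow> 'a \<Rightarrow> 'a" and X :: "'a set" where
  incl: "x \<in> X \<Longrightarrow> x \<in> sgen f X"
| mult: "\<lbrakk>x \<in> sgen f X; y \<in> sgen f X\<rbrakk> \<Longrightarrow> f x y \<in> sgen f X"

text \<open>
  A semigroup has no unit, so \<open>spow f a k\<close> is the power \<open>a\<^sup>k\<close> only for \<open>k \<ge> 1\<close>; at \<open>k = 0\<close> it has
  the junk value \<open>a\<close>. All exponents below are therefore required to be positive.
\<close>

definition spow :: "('a \<Rightarrow> 'a \<Rightarrow> 'a) \<Rightarrow> 'a \<Rightarrow> nat \<Rightarrow> 'a" where
  "spow f a k = (f a ^^ (k - 1)) a"

definition sindex :: "('a \<Rightarrow> 'a \<Rightarrow> 'a) \<Rightarrow> 'a \<Rightarrow> nat" where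
  "sindex f a = (LEAST x. 0 < x \<and> (\<exists>y. 0 < y \<and> y \<noteq> x \<and> spow f a x = spow f a y))"

definition speriod :: "('a \<Rightarrow> 'a \<Rightarrow> 'a) \<Rightarrow> 'a \<Rightarrow> nat" where
  "speriod f a = (LEAST x. 0 < x \<and> spow f a (sindex f a + x) = spow f a (sindex f a))"

text \<open>\<open>is_M S f m r\<close> renders \<open>S = \<langle>a : a\<^bsup>m+r\<^esup> = a\<^sup>m\<rangle>\<close>, that is, \<open>S = M(m,r)\<close>.\<close>

definition is_M :: "'a set \<Rightarrow> ('a \<Rightarrow> 'a \<Rightarrow> 'a) \<Rightarrow> nat \<Rightarrow> nat \<Rightarrow> bool" where
  "is_M S f m r \<longleftrightarrow> (\<exists>a\<in>S. S = sgen f {a} \<and> sindex f a = m \<and> speriod f a = r)"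

text \<open>
  As usual in this graph library, a simple graph is a symmetric loop-free digraph without
  parallel arcs; see \<open>pair_graph_cyclic_graph\<close> below.
\<close>

definition cyclic_graph :: "'a set \<Rightarrow> ('a \<Rightarrow> 'a \<Rightarrow> 'a) \<Rightarrow> 'a pair_pre_digraph" where
  "cyclic_graph S f =
    \<lparr> pverts = S,
      parcs = {(x, y). x \<in> S \<and> y \<in> S \<and> x \<noteq> y \<and> (\<exists>z\<in>S. sgen f {x, y} = sgen f {z})} \<rparr>"

definition complete_graph :: "('a, 'b) pre_digraph \<Rightarrow> bool" where
  "complete_graph G \<longleftrightarrow> (\<forall>u \<in> verts G. \<forall>v \<in> verts G. u \<noteq> v \<longrightarrow> u \<rightarrow>\<^bsub>G\<^esub> v)"

context finite_semigroup
begin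

lemma pair_graph_cyclic_graph: "pair_graph (cyclic_graph S f)"
proof -
  have "parcs (cyclic_graph S f) \<subseteq> S \<times> S"
    by (auto simp: cyclic_graph_def)
  then have "finite (parcs (cyclic_graph S f))"
    by (rule finite_subset) (simp add: finite_carrier)
  then show ?thesis
    by unfold_locales
      (auto simp: cyclic_graph_def finite_carrier symmetric_def insert_commute intro!: symI)
qed

lemma complete_graph_cyclic_graph_iff:
  "complete_graph (cyclic_graph S f) \<longleftrightarrow> complete_digraph (card S) (cyclic_graph S f)"
  unfolding complete_digraph_pair_def complete_graph_def
  by (auto simp: cyclic_graph_def finite_carrier set_eq_iff)

lemma spow_in: "a \<in> S \<Longrightarrow> spow f a k \<in> S"
proof -
  assume a: "a \<in> S"
  have "(f a ^^ n) a \<in> S" for n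
    by (induction n) (simp_all add: a closed)
  then show ?thesis by (simp add: spow_def)
qed

lemma spow_add:
  assumes a: "a \<in> S" and "0 < k" "0 < l"
  shows "spow f a (k + l) = f (spow f a k) (spow f a l)"
  using \<open>0 < k\<close>
proof (induction k)
  case (Suc k)
  have Suc': "spow f a (Suc n) = f a (spow f a n)" if "0 < n" for n
    using that by (cases n) (simp_all add: spow_def)
  show ?case
  proof (cases "k = 0")
    case True
    then show ?thesis using Suc'[OF \<open>0 < l\<close>] by (simp add: spow_def)
  next
    case False
    then show ?thesis
      using Suc.IH Suc'[of k] Suc'[of "k + l"] a by (simp add: assoc spow_in)
  qed
qed simp

lemma sgen_singleton:
  assumes a: "a \<in> S"
  shows "sgen f {a} = {spow f a k | k. 0 < k}"
proof (intro equalityI subsetI)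
  fix x assume "x \<in> sgen f {a}"
  then show "x \<in> {spow f a k | k. 0 < k}"
  proof induction
    case (incl x)
    then have "x = spow f a 1" by (simp add: spow_def)
    then show ?case by blast
  next
    case (mult x y)
    then obtain k l where "0 < k" "0 < l" "x = spow f a k" "y = spow f a l" by blast
    then have "f x y = spow f a (k + l)" "0 < k + l" by (simp_all add: spow_add a)
    then show ?case by blast
  qed
next
  have *: "(f a ^^ n) a \<in> sgen f {a}" for n
    by (induction n) (auto intro: sgen.intros)
  fix x assume "x \<in> {spow f a k | k. 0 < k}"
  then show "x \<in> sgen f {a}" using * by (auto simp: spow_def)
qed

end

end

theory Submission
  imports Defs
begin

text \<open>
  Completeness of the cyclic graph says that every two-generated subsemigroup is monogenic. A finite
  semigroup with this property is itself monogenic: if \<open>\<langle>a\<rangle>\<close> is as large as possible, then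
  \<open>\<langle>a, b\<rangle> = \<langle>z\<rangle>\<close> contains \<open>\<langle>a\<rangle>\<close>, hence equals it, for every \<open>b\<close>
  (\<open>monogenic_if_pairs_monogenic\<close>). It remains to decide which \<open>\<langle>a\<rangle>\<close>, of index \<open>m\<close> and period
  \<open>r\<close>, have the property.

  The powers with exponent at least \<open>m\<close> form a cyclic group of order \<open>r\<close>, and any two of
  them generate a cyclic subgroup (\<open>sgen_pair_kernel\<close>). The element \<open>a\<close> together with anything
  generates everything. This settles \<open>m = 1\<close> and \<open>m = 2\<close>. For \<open>m = 3\<close> only the pairs containing
  \<open>a\<^sup>2\<close> are left. If \<open>r\<close> is odd, adding \<open>r\<close> changes the parity of an exponent, so
  \<open>\<langle>a\<^sup>2\<rangle>\<close> contains the whole cyclic group and every such pair generates just \<open>\<langle>a\<^sup>2\<rangle>\<close>.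

  The obstruction in all other cases is the pair \<open>a\<^sup>2, a\<^sup>3\<close>. When \<open>m \<ge> 3\<close>, the element \<open>a\<^sup>2\<close> has no
  other expression as a power of \<open>a\<close>, so a single generator would have to be \<open>a\<^sup>2\<close> itself, and
  \<open>a\<^sup>3\<close> would equal a power \<open>a\<^bsup>2t\<^esup>\<close>. This is impossible for \<open>m \<ge> 4\<close>, and for \<open>m = 3\<close> it makes
  \<open>r\<close> divide the odd number \<open>2t - 3\<close> (\<open>square_cube_obstruction\<close>).
\<close>

lemma sgen_mono_closed: "X \<subseteq> sgen f Y \<Longrightarrow> sgen f X \<subseteq> sgen f Y"
proof
  fix x assume "X \<subseteq> sgen f Y" "x \<in> sgen f X"
  from this(2,1) show "x \<in> sgen f Y"
    by induction (auto intro: sgen.mult)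
qed

lemma sgen_insert_absorb: "y \<in> sgen f {x} \<Longrightarrow> sgen f {x, y} = sgen f {x}"
  by (intro equalityI sgen_mono_closed) (auto intro: sgen.incl)

lemma complete_cyclic_graph_iff:
  "complete_graph (cyclic_graph S f) \<longleftrightarrow> (\<forall>x\<in>S. \<forall>y\<in>S. \<exists>z\<in>S. sgen f {x, y} = sgen f {z})"
proof -
  have "complete_graph (cyclic_graph S f) \<longleftrightarrow>
      (\<forall>x\<in>S. \<forall>y\<in>S. x \<noteq> y \<longrightarrow> (\<exists>z\<in>S. sgen f {x, y} = sgen f {z}))"
    by (auto simp: complete_graph_def cyclic_graph_def)
  also have "\<dots> \<longleftrightarrow> (\<forall>x\<in>S. \<forall>y\<in>S. \<exists>z\<in>S. sgen f {x, y} = sgen f {z})"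
  proof (intro ball_cong refl)
    fix x y assume "x \<in> S"
    then show "(x \<noteq> y \<longrightarrow> (\<exists>z\<in>S. sgen f {x, y} = sgen f {z})) \<longleftrightarrow> (\<exists>z\<in>S. sgen f {x, y} = sgen f {z})"
      by (cases "x = y") auto
  qed
  finally show ?thesis .
qed

context finite_semigroup
begin

section \<open>Powers, index and period\<close>

lemma sgen_subset_carrier: "X \<subseteq> S \<Longrightarrow> sgen f X \<subseteq> S"
proof
  fix x assume "X \<subseteq> S" "x \<in> sgen f X"
  from this(2,1) show "x \<in> S"
    by induction (auto intro: closed)
qed

lemma spow_1 [simp]: "spow f a (Suc 0) = a"
  by (simp add: spow_def)

lemma spow_spow:
  assumes "a \<in> S" "0 < k" "0 < l"
  shows "spow f (spow f a k) l = spow f a (k * l)"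
  using assms(3)
proof (induction l rule: nat_induct_non_zero)
  case (Suc l)
  have "spow f (spow f a k) (l + 1) = f (spow f a (k * l)) (spow f a k)"
    using Suc assms by (subst spow_add) (simp_all add: spow_in)
  also have "\<dots> = spow f a (k * l + k)"
    using Suc assms by (simp add: spow_add)
  finally show ?case by (simp add: add.commute)
qed simp

lemma spow_in_sgen:
  assumes "b \<in> sgen f X" "X \<subseteq> S" "0 < k"
  shows "spow f b k \<in> sgen f X"
proof -
  have "b \<in> S" using assms sgen_subset_carrier by blast
  then have "spow f b k \<in> sgen f {b}" using assms by (auto simp: sgen_singleton)
  then show ?thesis using assms sgen_mono_closed[of "{b}" f X] by blast
qed

text \<open>
  The index is a least number, so it is meaningful only once some power repeats; finiteness of the
  carrier forces this by the pigeonhole principle.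
\<close>

lemma sindex_props:
  assumes a: "a \<in> S"
  shows "0 < sindex f a"
    and "\<exists>y. 0 < y \<and> y \<noteq> sindex f a \<and> spow f a (sindex f a) = spow f a y"
proof -
  have "\<not> inj_on (spow f a) {0<..}"
  proof
    assume "inj_on (spow f a) {0<..}"
    moreover have "finite (spow f a ` {0<..})"
      by (rule finite_subset[OF _ finite_carrier]) (auto simp: spow_in a)
    ultimately show False
      using finite_imageD infinite_Ioi by blast
  qed
  then have "\<exists>x. 0 < x \<and> (\<exists>y. 0 < y \<and> y \<noteq> x \<and> spow f a x = spow f a y)"
    unfolding inj_on_def by auto
  from LeastI_ex[OF this]
  show "0 < sindex f a" "\<exists>y. 0 < y \<and> y \<noteq> sindex f a \<and> spow f a (sindex f a) = spow f a y"
    unfolding sindex_def by auto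
qed

lemma sindex_le:
  "\<lbrakk>0 < k; 0 < l; l \<noteq> k; spow f a k = spow f a l\<rbrakk> \<Longrightarrow> sindex f a \<le> k"
  unfolding sindex_def by (rule Least_le) auto

lemma speriod_props:
  assumes a: "a \<in> S"
  shows "0 < speriod f a"
    and "spow f a (sindex f a + speriod f a) = spow f a (sindex f a)"
proof -
  obtain y where y: "0 < y" "y \<noteq> sindex f a" "spow f a (sindex f a) = spow f a y"
    using sindex_props(2)[OF a] by blast
  have "sindex f a \<le> y"
    using sindex_le[of y "sindex f a" a] y sindex_props(1)[OF a] by simp
  then have "\<exists>x. 0 < x \<and> spow f a (sindex f a + x) = spow f a (sindex f a)"
    using y by (intro exI[of _ "y - sindex f a"]) simp
  from LeastI_ex[OF this]
  show "0 < speriod f a" "spow f a (sindex f a + speriod f a) = spow f a (sindex f a)"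
    unfolding speriod_def by auto
qed

lemma spow_add_period:
  assumes a: "a \<in> S" and k: "sindex f a \<le> k"
  shows "spow f a (k + speriod f a * t) = spow f a k"
proof (induction t)
  case (Suc t)
  let ?m = "sindex f a" and ?r = "speriod f a"
  have "spow f a (n + ?r) = spow f a n" if "?m \<le> n" for n
  proof (cases "n = ?m")
    case False
    obtain d where d: "n = ?m + d" using \<open>?m \<le> n\<close> le_Suc_ex by blast
    then have "0 < d" using False by simp
    have "spow f a (n + ?r) = spow f a ((?m + ?r) + d)"
      by (simp add: d ac_simps)
    also have "\<dots> = f (spow f a (?m + ?r)) (spow f a d)"
      using \<open>0 < d\<close> by (intro spow_add a) (simp_all add: sindex_props a)
    also have "\<dots> = spow f a n"
      using d \<open>0 < d\<close> by (simp only: speriod_props a) (simp add: spow_add a sindex_props)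
    finally show ?thesis .
  qed (simp add: speriod_props a)
  from this[of "k + ?r * t"] show ?case
    using Suc k by (simp add: ac_simps)
qed simp

text \<open>
  Dividing \<open>x\<close> by the period leaves a remainder that also returns to \<open>a\<^sup>m\<close>; by minimality of the
  period it cannot be positive.
\<close>

lemma speriod_dvd:
  assumes a: "a \<in> S" and eq: "spow f a (sindex f a + x) = spow f a (sindex f a)"
  shows "speriod f a dvd x"
proof (rule ccontr)
  let ?m = "sindex f a" and ?r = "speriod f a"
  assume "\<not> ?r dvd x"
  then have pos: "0 < x mod ?r" by (simp add: mod_greater_zero_iff_not_dvd)
  have "spow f a (?m + x mod ?r) = spow f a (?m + x mod ?r + ?r * (x div ?r))"
    by (rule spow_add_period[OF a, symmetric]) simp
  also have "\<dots> = spow f a (?m + x)"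
    by (simp only: add.assoc mod_mult_div_eq)
  finally have "?r \<le> x mod ?r"
    using eq pos unfolding speriod_def[of f a] by (intro Least_le) simp
  moreover have "x mod ?r < ?r"
    by (simp add: speriod_props a)
  ultimately show False by simp
qed

section \<open>Subsemigroups generated by two elements\<close>

text \<open>
  A generator is found by maximality: any element whose monogenic subsemigroup has the largest
  possible cardinality works, because adjoining a second element cannot enlarge that subsemigroup.
\<close>

lemma monogenic_if_pairs_monogenic:
  assumes pairs: "\<And>x y. \<lbrakk>x \<in> S; y \<in> S\<rbrakk> \<Longrightarrow> \<exists>z\<in>S. sgen f {x, y} = sgen f {z}"
  shows "\<exists>a\<in>S. S = sgen f {a}"
proof -
  have "Max ((\<lambda>x. card (sgen f {x})) ` S) \<in> (\<lambda>x. card (sgen f {x})) ` S"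
    using finite_carrier nonempty by (intro Max_in) simp_all
  then obtain a where a: "a \<in> S" "Max ((\<lambda>x. card (sgen f {x})) ` S) = card (sgen f {a})"
    by blast
  have max: "card (sgen f {z}) \<le> card (sgen f {a})" if "z \<in> S" for z
    unfolding a(2)[symmetric] using that finite_carrier by (intro Max_ge) simp_all
  have "b \<in> sgen f {a}" if b: "b \<in> S" for b
  proof -
    obtain z where z: "z \<in> S" "sgen f {a, b} = sgen f {z}"
      using pairs[OF a(1) b] by blast
    have "sgen f {a} \<subseteq> sgen f {z}"
      unfolding z(2)[symmetric] by (rule sgen_mono_closed) (auto intro: sgen.incl)
    moreover have "finite (sgen f {z})"
      using z sgen_subset_carrier[of "{z}"] finite_carrier finite_subset by auto
    ultimately have "sgen f {a} = sgen f {z}"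
      using max[OF z(1)] by (simp add: card_seteq)
    then show ?thesis
      using z(2) by (auto intro: sgen.incl)
  qed
  then show ?thesis
    using a sgen_subset_carrier[of "{a}"] by blast
qed

text \<open>
  Beyond the index, exponents matter only modulo the period \<open>r\<close>, so \<open>a\<^sup>i\<close> and \<open>a\<^sup>j\<close> generate
  the same subgroup as a power whose exponent is congruent to \<open>d = gcd i j\<close>. Bezout gives
  \<open>i x = j y + d\<close>; the subtraction of \<open>j y\<close> is replaced by the addition of \<open>(r - 1) j y\<close>.
\<close>

lemma sgen_pair_kernel:
  assumes a: "a \<in> S" and ij: "sindex f a \<le> i" "sindex f a \<le> j"
  shows "\<exists>z\<in>S. sgen f {spow f a i, spow f a j} = sgen f {z}"
proof -
  let ?m = "sindex f a" and ?r = "speriod f a"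
  let ?H = "sgen f {spow f a i, spow f a j}"
  have m: "0 < ?m" and r: "0 < ?r" by (simp_all add: sindex_props speriod_props a)
  then have i: "0 < i" and j: "0 < j" using ij by linarith+
  obtain d x y where d: "d dvd i" "d dvd j" and xy: "i * x = j * y + d"
    using bezout_add_strong_nat[of i j] i by blast
  have d0: "0 < d" using d i by (auto intro: Nat.gr0I)
  \<comment> \<open>The summand \<open>i r m\<close> pushes the exponent beyond the index without changing its residue.\<close>
  define N where "N = i * (x + ?r * ?m) + j * (y * (?r - 1))"
  have "N = j * y + d + i * ?r * ?m + j * y * (?r - 1)"
    by (simp add: N_def algebra_simps xy)
  also have "j * y + d + i * ?r * ?m + j * y * (?r - 1) = d + ?r * (j * y + i * ?m)"
    using r by (cases ?r) (simp_all add: algebra_simps)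
  finally have N: "N = d + ?r * (j * y + i * ?m)" .
  have N0: "0 < N" using d0 N by simp
  have gens: "spow f a i \<in> ?H" "spow f a j \<in> ?H" by (auto intro: sgen.incl)
  have sub: "{spow f a i, spow f a j} \<subseteq> S" by (simp add: spow_in a)
  have "spow f a N \<in> ?H"
  proof -
    have 1: "0 < x + ?r * ?m" using r m by simp
    then have I: "spow f a (i * (x + ?r * ?m)) \<in> ?H"
      using spow_in_sgen[OF gens(1) sub 1] by (simp add: spow_spow a i)
    show ?thesis
    proof (cases "y * (?r - 1) = 0")
      case True
      then have "N = i * (x + ?r * ?m)"
        unfolding N_def by (simp only: True mult_0_right add_0_right)
      with I show ?thesis by simp
    next
      case False
      then have 2: "0 < y * (?r - 1)" by simp
      have J: "spow f a (j * (y * (?r - 1))) \<in> ?H"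
        using spow_in_sgen[OF gens(2) sub 2] spow_spow[OF a j 2] by simp
      have "spow f a N = f (spow f a (i * (x + ?r * ?m))) (spow f a (j * (y * (?r - 1))))"
        unfolding N_def by (rule spow_add[OF a]) (use 1 2 i j in simp_all)
      with sgen.mult[OF I J] show ?thesis by simp
    qed
  qed
  moreover have "spow f a n \<in> sgen f {spow f a N}" if n: "?m \<le> n" "d dvd n" for n
  proof -
    obtain t where t: "n = d * t" using n by blast
    have t0: "0 < t" using t n m by (auto intro: Nat.gr0I)
    have "spow f (spow f a N) t = spow f a (n + ?r * ((j * y + i * ?m) * t))"
      by (subst spow_spow) (simp_all add: a N0 t0, simp add: N t algebra_simps)
    also have "\<dots> = spow f a n" using n by (simp add: spow_add_period a)
    finally show ?thesis
      using t0 a by (force simp: sgen_singleton spow_in)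
  qed
  ultimately have "?H = sgen f {spow f a N}"
    using ij d by (intro equalityI sgen_mono_closed) simp_all
  then show ?thesis using spow_in[OF a] by blast
qed

text \<open>
  Below the index a power determines its exponent. Hence a single generator of
  \<open>\<langle>a\<^sup>2, a\<^sup>3\<rangle>\<close> must be \<open>a\<^sup>2\<close>, and \<open>a\<^sup>3\<close> must coincide with an even power of \<open>a\<close>.
\<close>

lemma square_cube_obstruction:
  assumes a: "a \<in> S" and m: "3 \<le> sindex f a"
    and z: "z \<in> S" "sgen f {spow f a 2, spow f a 3} = sgen f {z}"
  shows "sindex f a = 3 \<and> odd (speriod f a)"
proof -
  have "sgen f {spow f a 2, spow f a 3} \<subseteq> {spow f a k | k. 2 \<le> k}"
  proof
    fix x assume "x \<in> sgen f {spow f a 2, spow f a 3}"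
    then show "x \<in> {spow f a k | k. 2 \<le> k}"
    proof induction
      case (incl x)
      then show ?case by fastforce
    next
      case (mult x y)
      then obtain k l where "2 \<le> k" "2 \<le> l" "x = spow f a k" "y = spow f a l" by blast
      then show ?case
        using spow_add[OF a, of k l] by (intro CollectI exI[of _ "k + l"]) simp
    qed
  qed
  moreover have "z \<in> sgen f {z}" by (auto intro: sgen.incl)
  ultimately obtain k where k: "2 \<le> k" "z = spow f a k" using z(2) by blast
  have pow: "\<exists>t>0. spow f a n = spow f a (k * t)" if "n \<in> {2, 3}" for n
  proof -
    have "spow f a n \<in> sgen f {z}"
      unfolding z(2)[symmetric] using that by (auto intro: sgen.incl)
    then show ?thesis
      using k a by (auto simp: sgen_singleton spow_in spow_spow)
  qed
  obtain s where s: "0 < s" "spow f a 2 = spow f a (k * s)" using pow[of 2] by auto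
  have "k * s = 2"
    using sindex_le[of 2 "k * s" a] s k m by fastforce
  then have k2: "k = 2"
    using k s by (cases s) auto
  obtain t where t: "0 < t" "spow f a 3 = spow f a (2 * t)" using pow[of 3] k2 by auto
  have ne: "2 * t \<noteq> 3" by presburger
  then have m3: "sindex f a = 3"
    using sindex_le[of 3 "2 * t" a] t m by simp
  moreover have "3 \<le> 2 * t"
    using sindex_le[of "2 * t" 3 a] t m3 ne by simp
  then have "speriod f a dvd 2 * t - 3"
    using speriod_dvd[OF a, of "2 * t - 3"] m3 t by simp
  moreover have "odd (2 * t - 3)"
    using \<open>3 \<le> 2 * t\<close> by presburger
  ultimately show ?thesis by (meson dvd_trans)
qed

section \<open>Monogenic semigroups with complete cyclic graph\<close>

text \<open>
  Even exponents are immediate. An odd exponent \<open>k \<ge> 2\<close> is at least \<open>3\<close>, hence not below the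
  index, so the odd period may be added to it, which makes it even.
\<close>

lemma sgen_square_contains:
  assumes a: "a \<in> S" and m: "sindex f a \<le> 3" and r: "odd (speriod f a)" and k: "2 \<le> k"
  shows "spow f a k \<in> sgen f {spow f a 2}"
proof -
  have even_case: "spow f a n \<in> sgen f {spow f a 2}" if "even n" "0 < n" for n
  proof -
    obtain t where "n = 2 * t" using \<open>even n\<close> by (rule evenE)
    moreover have "0 < t" using calculation \<open>0 < n\<close> by simp
    ultimately show ?thesis using a by (force simp: sgen_singleton spow_in spow_spow)
  qed
  show ?thesis
  proof (cases "even k")
    case False
    then have "3 \<le> k" using k by presburger
    then have "spow f a (k + speriod f a * 1) = spow f a k"
      using m by (intro spow_add_period a) simp
    then show ?thesis using even_case[of "k + speriod f a"] False r k by simp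
  qed (use even_case k in auto)
qed

lemma pairs_monogenic_if_small_index:
  assumes a: "a \<in> S" and S: "S = sgen f {a}"
    and m: "sindex f a \<le> 2 \<or> sindex f a = 3 \<and> odd (speriod f a)"
    and xy: "x \<in> S" "y \<in> S"
  shows "\<exists>z\<in>S. sgen f {x, y} = sgen f {z}"
proof -
  have main: "\<exists>z\<in>S. sgen f {spow f a i, spow f a j} = sgen f {z}"
    if "0 < i" "i \<le> j" for i j
  proof -
    have j_in: "spow f a j \<in> S" by (rule spow_in[OF a])
    have "i = 1 \<or> sindex f a \<le> i \<or> i = 2 \<and> sindex f a = 3 \<and> odd (speriod f a)"
      using m that by linarith
    then consider "i = 1" | "sindex f a \<le> i" | "i = 2" "sindex f a = 3" "odd (speriod f a)"
      by blast
    then show ?thesis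
    proof cases
      case 1
      have "spow f a j \<in> sgen f {a}" using j_in S by blast
      from sgen_insert_absorb[OF this] show ?thesis using 1 a by auto
    next
      case 2
      then show ?thesis using sgen_pair_kernel[OF a] that by simp
    next
      case 3
      then have "spow f a j \<in> sgen f {spow f a i}"
        using sgen_square_contains[OF a, of j] that by simp
      then show ?thesis using sgen_insert_absorb spow_in[OF a] by metis
    qed
  qed
  obtain i j where "0 < i" "0 < j" "x = spow f a i" "y = spow f a j"
    using xy by (subst (asm) (1 2) S) (auto simp: sgen_singleton a)
  then show ?thesis
    using main[of i j] main[of j i] by (cases "i \<le> j") (auto simp: insert_commute)
qed

end

theorem theorem3p3:
  fixes S :: "'a set" and f :: "'a \<Rightarrow> 'a \<Rightarrow> 'a"
  assumes "finite_semigroup S f"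
  shows "complete_graph (cyclic_graph S f) \<longleftrightarrow>
    (\<exists>r>0. is_M S f 1 r \<or> is_M S f 2 r \<or> (is_M S f 3 r \<and> odd r))"
proof -
  interpret finite_semigroup S f by fact
  show ?thesis
    unfolding complete_cyclic_graph_iff
  proof
    assume pairs: "\<forall>x\<in>S. \<forall>y\<in>S. \<exists>z\<in>S. sgen f {x, y} = sgen f {z}"
    then obtain a where a: "a \<in> S" "S = sgen f {a}"
      using monogenic_if_pairs_monogenic by blast
    obtain z where z: "z \<in> S" "sgen f {spow f a 2, spow f a 3} = sgen f {z}"
      using pairs spow_in[OF a(1)] by blast
    have "sindex f a = 1 \<or> sindex f a = 2 \<or> sindex f a = 3 \<and> odd (speriod f a)"
      using square_cube_obstruction[OF a(1) _ z] sindex_props(1)[OF a(1)] by linarith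
    then show "\<exists>r>0. is_M S f 1 r \<or> is_M S f 2 r \<or> (is_M S f 3 r \<and> odd r)"
      unfolding is_M_def using a speriod_props(1)[OF a(1)] by blast
  next
    assume "\<exists>r>0. is_M S f 1 r \<or> is_M S f 2 r \<or> (is_M S f 3 r \<and> odd r)"
    then obtain a where "a \<in> S" "S = sgen f {a}"
      "sindex f a \<le> 2 \<or> sindex f a = 3 \<and> odd (speriod f a)"
      unfolding is_M_def by fastforce
    then show "\<forall>x\<in>S. \<forall>y\<in>S. \<exists>z\<in>S. sgen f {x, y} = sgen f {z}"
      using pairs_monogenic_if_small_index by blast
  qed
qed

end
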